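(* Let $0<\beta<1$, $\epsilon>0$, and let $0=t_0<t_1<\cdots<t_N=T$ be a time mesh with step sizes $\tau_k=t_k-t_{k-1}$ and step ratios $r_k=\tau_k/\tau_{k-1}$ $(2\le k\le N)$ satisfying $$r_{k+1}\ \ge\ r_*(r_k):=\left[\frac{(2^\beta-1)\rho(r_k)}{\rho(2r_k)-\rho(r_k)}\right]^{\frac1{1-\beta}}\quad\text{for } 2\le k\le N-1,\qquad \rho(z):=(z+1)^{1+\beta}-z^{1+\beta}-1 .$$ Let $u^0,u^1,\dots,u^N$ be (sufficiently smooth, real-valued, $\Omega$-periodic) functions satisfying the variable-step Crank-Nicolson scheme for the time-fractional Klein-Gordon model $$\frac{u^n-u^{n-1}}{\tau_n}+\sum_{k=1}^{n}a_{n-k}^{(\beta,n)}\tau_k\zeta^{k-\frac12}=0,\qquad \zeta^{n-\frac12}=f(u)^{n-\frac12}-\epsilon^2\Delta u^{n-\frac12},\qquad 1\le n\le N .$$ Then the scheme is energy stable in the sense that it preserves the following discrete energy dissipation law: for every $1\le n\le N$, $$\frac{\mathcal E_\beta[u^n]-\mathcal E_\beta[u^{n-1}]}{\tau_n}+\frac{1}{2\tau_n}\sum_{j=1}^{n-1}\left(\frac{1}{{}^{r}\mathsf p_{n-j}^{(\beta,n)}}-\frac{1}{{}^{r}\mathsf p_{n-j-1}^{(\beta,n)}}\right)\left\|\sum_{k=1}^{j}{}^{r}\mathsf p_{n-k}^{(\beta,n)}(v^k-v^{k-1})\right\|^2=0,$$ where $v^0:=0$, $v^j:=\sum_{\ell=1}^{j}\mathsf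 a_{j-\ell}^{(\beta,j)}\tau_\ell\zeta^{\ell-\frac12}$ for $j\ge1$, and $$\mathcal E_\beta[u^n]:=E[u^n]+\frac{1}{2}\sum_{j=1}^n\mathsf p_{n-j}^{(\beta,n)}\|v^j\|^2,\qquad E[u]:=\int_\Omega\left(\frac{\epsilon^2}{2}|\nabla u|^2+\frac14(u^2-1)^2\right)d\mathbf x .$$
   Context: $\Omega\subseteq\mathbb R^2$ is a periodic cell (periodic boundary conditions), $\langle\cdot,\cdot\rangle$ and $\|\cdot\|$ are the $L^2(\Omega)$ inner product and norm. $u^{n-\frac12}:=(u^n+u^{n-1})/2$, and $$f(u)^{n-\frac12}:=\tfrac12\left[(u^n)^2+(u^{n-1})^2\right]u^{n-\frac12}-u^{n-\frac12}.$$ $\omega_\beta(t):=t^{\beta-1}/\Gamma(\beta)$ for $t>0$, and for $1\le k\le n\le N$, $$a_{n-k}^{(\beta,n)}:=\frac{1}{\tau_n\tau_{k}}\int_{t_{n-1}}^{t_n}\int_{t_{k-1}}^{\min\{t,t_k\}}\omega_{\beta}(t-s)\,ds\,dt .$$ The modified kernels are $\mathsf a_{0}^{(\beta,n)}:=2a_{0}^{(\beta,n)}$ and $\mathsf a_{n-j}^{(\beta,n)}:=a_{n-j}^{(\beta,n)}$ for $1\le j\le n-1$. For any triangular array $\{a_{n-k}^{(n)}\}_{1\le k\le n}$ with $a_0^{(n)}\ne0$, the discrete orthogonal convolution (DOC) kernels are $\theta_0^{(n)}:=1/a_0^{(n)}$ and $\theta_{n-k}^{(n)}:=-\frac{1}{a_0^{(k)}}\sum_{j=k+1}^n\theta_{n-j}^{(n)}a_{j-k}^{(j)}$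 for $1\le k\le n-1$; the DCC kernels are $p_{n-k}^{(n)}:=\sum_{j=k}^n\theta_{j-k}^{(j)}$ and the RCC kernels are ${}^{r}p_{n-k}^{(n)}:=\sum_{j=k}^n\theta_{n-j}^{(n)}$, for $1\le k\le n$. The kernels $\mathsf p_{n-k}^{(\beta,n)}$ and ${}^{r}\mathsf p_{n-k}^{(\beta,n)}$ are the DCC and RCC kernels of the modified array $\mathsf a_{n-k}^{(\beta,n)}$. Empty sums are zero, so $\mathcal E_\beta[u^0]=E[u^0]$. *)

theory Defs
  imports "HOL-Analysis.Analysis"
begin

text \<open>
  The periods are the columns of an invertible matrix \<open>B\<close>, and the periodic cell is the
  parallelogram spanned by them at the corner \<open>c\<close>; a diagonal \<open>B\<close> with positive entries
  gives the axis-parallel rectangles.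
\<close>

definition periodic_cell :: "real^2 \<Rightarrow> real^2^2 \<Rightarrow> (real^2) set" where
  "periodic_cell c B = (\<lambda>y. c + B *v y) ` cbox 0 1"

definition cell_periodic :: "real^2^2 \<Rightarrow> (real^2 \<Rightarrow> real) \<Rightarrow> bool" where
  "cell_periodic B w \<longleftrightarrow> (\<forall>i x. w (x + column i B) = w x)"

definition partial_deriv :: "2 \<Rightarrow> (real^2 \<Rightarrow> real) \<Rightarrow> real^2 \<Rightarrow> real" where
  "partial_deriv i w x = frechet_derivative w (at x) (axis i 1)"

definition C1_fun :: "(real^2 \<Rightarrow> real) \<Rightarrow> bool" where
  "C1_fun w \<longleftrightarrow> (\<forall>x. w differentiable (at x)) \<and> (\<forall>i. continuous_on UNIV (partial_deriv i w))"

definition C2_fun :: "(real^2 \<Rightarrow> real) \<Rightarrow> bool" where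
  "C2_fun w \<longleftrightarrow> C1_fun w \<and> (\<forall>i. C1_fun (partial_deriv i w))"

definition grad :: "(real^2 \<Rightarrow> real) \<Rightarrow> real^2 \<Rightarrow> real^2" where
  "grad w x = (\<chi> i. partial_deriv i w x)"

definition laplacian :: "(real^2 \<Rightarrow> real) \<Rightarrow> real^2 \<Rightarrow> real" where
  "laplacian w x = (\<Sum>i\<in>UNIV. partial_deriv i (partial_deriv i w) x)"

text \<open>
  All integrands integrated below are nonnegative, so the Henstock--Kurzweil integral agrees with
  the Lebesgue integral.
\<close>

definition L2_norm :: "(real^2) set \<Rightarrow> (real^2 \<Rightarrow> real) \<Rightarrow> real" where
  "L2_norm \<Omega> w = sqrt (integral \<Omega> (\<lambda>x. (w x)\<^sup>2))"

definition energy :: "real \<Rightarrow> (real^2) set \<Rightarrow> (real^2 \<Rightarrow> real) \<Rightarrow> real" where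
  "energy \<epsilon> \<Omega> w =
     integral \<Omega> (\<lambda>x. \<epsilon>\<^sup>2 / 2 * (norm (grad w x))\<^sup>2 + 1 / 4 * ((w x)\<^sup>2 - 1)\<^sup>2)"

definition tau :: "(nat \<Rightarrow> real) \<Rightarrow> nat \<Rightarrow> real" where
  "tau t k = t k - t (k - 1)"

definition step_ratio :: "(nat \<Rightarrow> real) \<Rightarrow> nat \<Rightarrow> real" where
  "step_ratio t k = tau t k / tau t (k - 1)"

definition rho :: "real \<Rightarrow> real \<Rightarrow> real" where
  "rho \<beta> z = (z + 1) powr (1 + \<beta>) - z powr (1 + \<beta>) - 1"

definition r_star :: "real \<Rightarrow> real \<Rightarrow> real" where
  "r_star \<beta> z =
     ((2 powr \<beta> - 1) * rho \<beta> z / (rho \<beta> (2 * z) - rho \<beta> z)) powr (1 / (1 - \<beta>))"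

text \<open>
  Every triangular array is indexed by its level and by the position of the weighted term, not by
  the difference of the two: \<open>A n k\<close> stands for \<open>a\<^bsub>n-k\<^esub>\<^bsup>(n)\<^esup>\<close> with \<open>1 \<le> k \<le> n\<close>.  So
  \<open>A n n\<close> is \<open>a\<^sub>0\<^bsup>(n)\<^esup>\<close>, \<open>A j k\<close> is \<open>a\<^bsub>j-k\<^esub>\<^bsup>(j)\<^esup>\<close>, and \<open>A n (j + 1)\<close> is
  \<open>a\<^bsub>n-j-1\<^esub>\<^bsup>(n)\<^esup>\<close>.  Values outside \<open>1 \<le> k \<le> n\<close> carry no meaning.
\<close>

text \<open>Meant for \<open>s > 0\<close>; the value at \<open>0\<close> does not affect the integrals.\<close>

definition omega :: "real \<Rightarrow> real \<Rightarrow> real" where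
  "omega \<beta> s = s powr (\<beta> - 1) / Gamma \<beta>"

definition a_kernel :: "real \<Rightarrow> (nat \<Rightarrow> real) \<Rightarrow> nat \<Rightarrow> nat \<Rightarrow> real" where
  "a_kernel \<beta> t n k =
     1 / (tau t n * tau t k) *
     integral {t (n - 1)..t n} (\<lambda>x. integral {t (k - 1)..min x (t k)} (\<lambda>s. omega \<beta> (x - s)))"

definition mod_kernel :: "real \<Rightarrow> (nat \<Rightarrow> real) \<Rightarrow> nat \<Rightarrow> nat \<Rightarrow> real" where
  "mod_kernel \<beta> t n k = (if k = n then 2 * a_kernel \<beta> t n n else a_kernel \<beta> t n k)"

function doc_kernel :: "(nat \<Rightarrow> nat \<Rightarrow> real) \<Rightarrow> nat \<Rightarrow> nat \<Rightarrow> real" where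
  "doc_kernel A n k =
     (if k < n then - (1 / A k k) * (\<Sum>j = k + 1..n. doc_kernel A n j * A j k)
      else 1 / A n n)"
  by auto
termination
  by (relation "Wellfounded.measure (\<lambda>(A, n, k). n - k)") auto

declare doc_kernel.simps [simp del]

definition dcc_kernel :: "(nat \<Rightarrow> nat \<Rightarrow> real) \<Rightarrow> nat \<Rightarrow> nat \<Rightarrow> real" where
  "dcc_kernel A n k = (\<Sum>j = k..n. doc_kernel A j k)"

definition rcc_kernel :: "(nat \<Rightarrow> nat \<Rightarrow> real) \<Rightarrow> nat \<Rightarrow> nat \<Rightarrow> real" where
  "rcc_kernel A n k = (\<Sum>j = k..n. doc_kernel A n j)"

text \<open>For \<open>n \<ge> 1\<close>, \<open>mid u n\<close>, \<open>f_mid u n\<close> and \<open>zeta \<epsilon> u n\<close> live at the half level \<open>n - 1/2\<close>.\<close>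

definition mid :: "(nat \<Rightarrow> real^2 \<Rightarrow> real) \<Rightarrow> nat \<Rightarrow> real^2 \<Rightarrow> real" where
  "mid u n x = (u n x + u (n - 1) x) / 2"

definition f_mid :: "(nat \<Rightarrow> real^2 \<Rightarrow> real) \<Rightarrow> nat \<Rightarrow> real^2 \<Rightarrow> real" where
  "f_mid u n x = 1 / 2 * ((u n x)\<^sup>2 + (u (n - 1) x)\<^sup>2) * mid u n x - mid u n x"

definition zeta :: "real \<Rightarrow> (nat \<Rightarrow> real^2 \<Rightarrow> real) \<Rightarrow> nat \<Rightarrow> real^2 \<Rightarrow> real" where
  "zeta \<epsilon> u n x = f_mid u n x - \<epsilon>\<^sup>2 * laplacian (mid u n) x"

definition CN_scheme ::
  "real \<Rightarrow> real \<Rightarrow> (real^2) set \<Rightarrow> (nat \<Rightarrow> real) \<Rightarrow> nat \<Rightarrow> (nat \<Rightarrow> real^2 \<Rightarrow> real) \<Rightarrow> bool" where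
  "CN_scheme \<beta> \<epsilon> \<Omega> t N u \<longleftrightarrow>
     (\<forall>n\<in>{1..N}. \<forall>x\<in>\<Omega>.
        (u n x - u (n - 1) x) / tau t n
          + (\<Sum>k = 1..n. a_kernel \<beta> t n k * tau t k * zeta \<epsilon> u k x) = 0)"

text \<open>The empty sum gives \<open>v\<^sup>0 = 0\<close>.\<close>

definition v_aux ::
  "real \<Rightarrow> real \<Rightarrow> (nat \<Rightarrow> real) \<Rightarrow> (nat \<Rightarrow> real^2 \<Rightarrow> real) \<Rightarrow> nat \<Rightarrow> real^2 \<Rightarrow> real" where
  "v_aux \<beta> \<epsilon> t u j x = (\<Sum>l = 1..j. mod_kernel \<beta> t j l * tau t l * zeta \<epsilon> u l x)"

definition mod_energy ::
  "real \<Rightarrow> real \<Rightarrow> (real^2) set \<Rightarrow> (nat \<Rightarrow> real) \<Rightarrow> (nat \<Rightarrow> real^2 \<Rightarrow> real) \<Rightarrow> nat \<Rightarrow> real" where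
  "mod_energy \<beta> \<epsilon> \<Omega> t u n =
     energy \<epsilon> \<Omega> (u n)
       + 1 / 2 * (\<Sum>j = 1..n. dcc_kernel (mod_kernel \<beta> t) n j * (L2_norm \<Omega> (v_aux \<beta> \<epsilon> t u j))\<^sup>2)"

end

theory Submission
  imports Defs
begin

text \<open>
  The law is an exact identity.  Write \<open>w\<^sup>k = \<tau>\<^sub>k \<zeta>\<^bsup>k-1/2\<^esup>\<close>, let \<open>A\<close> be the lower triangular matrix of
  the modified kernels and \<open>\<Theta>\<close> that of the DOC kernels, its inverse; so \<open>v = A w\<close> and
  \<open>w = \<Theta> v\<close>.

  Testing the scheme with \<open>w\<^sup>n\<close> turns the difference quotient into the increment of the
  classical energy: the nonlinearity is discretised so that its part is an exact difference of
  quartic potentials, and Green's formula on the periodic cell handles the Laplacian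
  (\<open>energy_increment\<close>).  As the modified diagonal is twice the original one, the memory term
  becomes \<open>w\<^sup>n v\<^sup>n - A\<^bsub>nn\<^esub> (w\<^sup>n)\<^sup>2 / 2\<close>, pointwise in space.

  This product is then decomposed algebraically (\<open>kernel_dissipation\<close>).  The RCC kernels \<open>r\<^sub>k\<close> are
  tail sums of the last row of \<open>\<Theta>\<close>, so summation by parts gives \<open>w\<^sup>n = S\<^sub>n\<close> with
  \<open>S\<^sub>j = \<Sum>\<^bsub>k\<le>j\<^esub> r\<^sub>k (v\<^sup>k - v\<^bsup>k-1\<^esup>)\<close>, and \<open>2 w\<^sup>n v\<^sup>n - A\<^bsub>nn\<^esub> (w\<^sup>n)\<^sup>2\<close> equals
  \<open>\<Sum>\<^sub>j \<Theta>\<^bsub>nj\<^esub> (v\<^sup>j)\<^sup>2 + \<Sum>\<^bsub>j<n\<^esub> (1/r\<^sub>j - 1/r\<^bsub>j+1\<^esub>) S\<^sub>j\<^sup>2\<close>.  The DCC kernels are column sums of \<open>\<Theta>\<close>,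
  hence the first sum is exactly the increment of the memory part of the modified energy.

  The divisions by \<open>r\<^sub>k\<close> are legitimate because the RCC kernels are positive
  (\<open>rcc_mod_kernel_pos\<close>): they satisfy a recursion whose coefficients are the drops
  \<open>A\<^bsub>j-1,k\<^esub> - A\<^bsub>jk\<^esub>\<close> down a column of \<open>A\<close>, and the columns decrease because
  \<open>A\<^bsub>jk\<^esub>\<close> averages the decreasing function \<open>\<omega>\<^sub>\<beta>\<close> over increasingly distant cells; at the diagonal
  the doubled entry wins since \<open>2 / (1 + \<beta>) > 1\<close>.
\<close>

section \<open>Orthogonal and complementary convolution kernels\<close>

text \<open>
  The DOC recursion is back substitution for a left inverse of \<open>A\<close>, one row at a time.
\<close>

lemma doc_kernel_orthogonal:
  assumes "A k k \<noteq> 0" "k \<le> n"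
  shows "(\<Sum>j = k..n. doc_kernel A n j * A j k) = (if k = n then 1 else 0)"
proof (cases "k = n")
  case True
  then show ?thesis using assms by (simp add: doc_kernel.simps[of A n n])
next
  case False
  then have "k < n" using assms by simp
  then have "doc_kernel A n k * A k k = - (\<Sum>j = k + 1..n. doc_kernel A n j * A j k)"
    using assms(1) by (simp add: doc_kernel.simps[of A n k])
  then show ?thesis
    using \<open>k < n\<close> by (simp add: sum.atLeast_Suc_atMost)
qed

lemma doc_kernel_inverts:
  fixes w :: "nat \<Rightarrow> real"
  assumes "\<And>k. k \<in> {1..n} \<Longrightarrow> A k k \<noteq> 0" "1 \<le> n"
  shows "(\<Sum>j = 1..n. doc_kernel A n j * (\<Sum>l = 1..j. A j l * w l)) = w n"
proof -
  have "(\<Sum>j = 1..n. doc_kernel A n j * (\<Sum>l = 1..j. A j l * w l))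
      = (\<Sum>j = 1..n. \<Sum>l = 1..j. doc_kernel A n j * A j l * w l)"
    by (simp add: sum_distrib_left mult.assoc)
  also have "\<dots> = (\<Sum>l = 1..n. \<Sum>j = l..n. doc_kernel A n j * A j l * w l)"
    by (simp add: sum.Sigma)
      (rule sum.reindex_bij_witness[of _ "\<lambda>(l, j). (j, l)" "\<lambda>(j, l). (l, j)"]; auto)
  also have "\<dots> = (\<Sum>l = 1..n. (if l = n then 1 else 0) * w l)"
    using assms by (intro sum.cong) (auto simp: doc_kernel_orthogonal simp flip: sum_distrib_right)
  also have "\<dots> = w n"
    using assms(2) by (simp add: if_distrib[of "\<lambda>x. x * _"] sum.delta cong: if_cong)
  finally show ?thesis .
qed

lemma doc_kernel_eq_rcc_diff:
  "j \<le> n \<Longrightarrow> doc_kernel A n j = rcc_kernel A n j - rcc_kernel A n (j + 1)"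
  by (simp add: rcc_kernel_def sum.atLeast_Suc_atMost)

lemma rcc_kernel_beyond: "n < j \<Longrightarrow> rcc_kernel A n j = 0"
  by (simp add: rcc_kernel_def)

text \<open>
  Insert the row differences \<open>doc_kernel_eq_rcc_diff\<close> into the orthogonality relation for column
  \<open>k\<close> and sum by parts: the differences move from the RCC kernels to the column of \<open>A\<close>.
\<close>

lemma rcc_kernel_recursion:
  assumes "A k k \<noteq> 0" "k < n"
  shows "rcc_kernel A n k * A k k = (\<Sum>j = k + 1..n. rcc_kernel A n j * (A (j - 1) k - A j k))"
proof -
  define r where "r = rcc_kernel A n"
  have parts: "(\<Sum>j = k..m. (r j - r (j + 1)) * A j k)
      = r k * A k k - (\<Sum>j = k + 1..m. r j * (A (j - 1) k - A j k)) - r (m + 1) * A m k"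
    if "k \<le> m" for m
    using that by (induction m rule: dec_induct) (auto simp: algebra_simps)
  have "0 = (\<Sum>j = k..n. (r j - r (j + 1)) * A j k)"
    using doc_kernel_orthogonal[of A k n] assms by (simp add: doc_kernel_eq_rcc_diff r_def)
  with parts[of n] assms show ?thesis
    by (simp add: r_def rcc_kernel_beyond)
qed

text \<open>
  Downward induction on \<open>k\<close> along \<open>rcc_kernel_recursion\<close>: column monotonicity makes all its
  terms nonnegative, and the strict drop below the diagonal makes the term \<open>j = k + 1\<close> positive.
\<close>

lemma rcc_kernel_pos:
  assumes diag: "\<And>k. k \<in> {1..n} \<Longrightarrow> A k k > 0"
    and drop: "\<And>k. 1 \<le> k \<Longrightarrow> k < n \<Longrightarrow> A (k + 1) k < A k k"
    and decr: "\<And>k j. 1 \<le> k \<Longrightarrow> k < j \<Longrightarrow> j < n \<Longrightarrow> A (j + 1) k \<le> A j k"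
  shows "k \<in> {1..n} \<Longrightarrow> rcc_kernel A n k > 0"
proof (induction "n - k" arbitrary: k rule: less_induct)
  case less
  show ?case
  proof (cases "k = n")
    case True
    then show ?thesis using diag[of n] less.prems
      by (simp add: rcc_kernel_def doc_kernel.simps[of A n n])
  next
    case False
    then have k: "1 \<le> k" "k < n" using less.prems by auto
    have IH: "rcc_kernel A n j > 0" if "j \<in> {k+1..n}" for j
      using less.hyps[of j] that k by auto
    have "0 < (\<Sum>j = k + 1..n. rcc_kernel A n j * (A (j - 1) k - A j k))"
    proof (rule sum_pos2[of _ "k + 1"])
      show "0 < rcc_kernel A n (k + 1) * (A (k + 1 - 1) k - A (k + 1) k)"
        using IH[of "k+1"] drop[of k] k by simp
      show "0 \<le> rcc_kernel A n j * (A (j - 1) k - A j k)" if j: "j \<in> {k + 1..n}" for j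
      proof -
        have "A j k \<le> A (j - 1) k"
        proof (cases "j = k + 1")
          case True
          then show ?thesis using drop[of k] k by simp
        next
          case False
          then show ?thesis using decr[of k "j - 1"] j k by auto
        qed
        then show ?thesis using IH[OF j] by simp
      qed
    qed (use k in auto)
    then have "0 < rcc_kernel A n k * A k k"
      using rcc_kernel_recursion[of A k n] diag[of k] k by simp
    then show ?thesis using diag[of k] k by (simp add: zero_less_mult_iff)
  qed
qed

section \<open>The algebraic energy dissipation identity\<close>

lemma sum_by_parts_forward:
  fixes r v :: "nat \<Rightarrow> real"
  assumes "v 0 = 0"
  shows "(\<Sum>j = 1..m. (r j - r (j + 1)) * v j)
       = (\<Sum>k = 1..m. r k * (v k - v (k - 1))) - r (m + 1) * v m"
  using assms by (induction m) (auto simp: algebra_simps)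

text \<open>
  Raising the level appends one entry, that of row \<open>n\<close>, to each column sum; this is how the memory
  part of the modified energy changes in one time step.
\<close>

lemma sum_dcc_kernel_step:
  assumes "1 \<le> n"
  shows "(\<Sum>j = 1..n. dcc_kernel A n j * s j)
       = (\<Sum>j = 1..n - 1. dcc_kernel A (n - 1) j * s j) + (\<Sum>j = 1..n. doc_kernel A n j * s j)"
proof -
  obtain m where n: "n = Suc m" using assms by (cases n) auto
  have "(\<Sum>j = 1..n. dcc_kernel A n j * s j)
      = (\<Sum>j = 1..n. dcc_kernel A m j * s j + doc_kernel A n j * s j)"
    by (intro sum.cong) (auto simp: n dcc_kernel_def algebra_simps)
  also have "\<dots> = (\<Sum>j = 1..n. dcc_kernel A m j * s j) + (\<Sum>j = 1..n. doc_kernel A n j * s j)"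
    by (rule sum.distrib)
  also have "(\<Sum>j = 1..n. dcc_kernel A m j * s j) = (\<Sum>j = 1..m. dcc_kernel A m j * s j)"
    by (simp add: n dcc_kernel_def)
  finally show ?thesis by (simp add: n)
qed

text \<open>
  Since \<open>S\<close> moves by \<open>r (v\<^sup>+ - v)\<close> in each step, completing squares shows that both sides
  have the same increment in \<open>n\<close>; the terms \<open>r n * (v n)\<^sup>2\<close> and \<open>(S n)\<^sup>2 / r n\<close> are the boundary
  terms of the two Abel summations.
\<close>

lemma square_telescoping_identity:
  fixes r v :: "nat \<Rightarrow> real"
  defines "S \<equiv> \<lambda>m. \<Sum>k = 1..m. r k * (v k - v (k - 1))"
  assumes "v 0 = 0" "1 \<le> n" and "\<And>j. j \<in> {1..n} \<Longrightarrow> r j \<noteq> 0"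
  shows "2 * S n * v n - (S n)\<^sup>2 / r n
       = (\<Sum>j = 1..n - 1. (r j - r (j + 1)) * (v j)\<^sup>2) + r n * (v n)\<^sup>2
         + (\<Sum>j = 1..n - 1. (1 / r j - 1 / r (j + 1)) * (S j)\<^sup>2)"
  using assms(3,4)
proof (induction n rule: dec_induct)
  case base
  then show ?case using \<open>v 0 = 0\<close> by (simp add: S_def power2_eq_square)
next
  case (step n)
  then obtain m where n: "n = Suc m" by (cases n) auto
  have r: "r n \<noteq> 0" "r (Suc n) \<noteq> 0" using step by auto
  have S: "S (Suc n) = S n + r (Suc n) * (v (Suc n) - v n)" by (simp add: S_def)
  have "2 * S n * v n - (S n)\<^sup>2 / r n
      = (\<Sum>j = 1..n - 1. (r j - r (j + 1)) * (v j)\<^sup>2) + r n * (v n)\<^sup>2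
         + (\<Sum>j = 1..n - 1. (1 / r j - 1 / r (j + 1)) * (S j)\<^sup>2)"
    using step by simp
  moreover have "2 * S (Suc n) * v (Suc n) - (S (Suc n))\<^sup>2 / r (Suc n)
      - (2 * S n * v n - (S n)\<^sup>2 / r n)
      = (r n - r (Suc n)) * (v n)\<^sup>2 + r (Suc n) * (v (Suc n))\<^sup>2 - r n * (v n)\<^sup>2
       + (1 / r n - 1 / r (Suc n)) * (S n)\<^sup>2"
    unfolding S using r by (simp add: field_simps power2_eq_square)
  ultimately show ?case by (simp add: n)
qed

text \<open>
  The identity \<open>square_telescoping_identity\<close> for the RCC kernels.  Its running sum ends in \<open>w n\<close>:
  by parts it is row \<open>n\<close> of the inverse of \<open>A\<close> applied to \<open>v = A w\<close>.
\<close>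

lemma kernel_dissipation:
  fixes w :: "nat \<Rightarrow> real" and A :: "nat \<Rightarrow> nat \<Rightarrow> real"
  defines "v \<equiv> \<lambda>j. \<Sum>l = 1..j. A j l * w l"
  assumes "1 \<le> n" and diag: "\<And>k. k \<in> {1..n} \<Longrightarrow> A k k \<noteq> 0"
    and rcc: "\<And>k. k \<in> {1..n} \<Longrightarrow> rcc_kernel A n k \<noteq> 0"
  shows "2 * w n * v n - A n n * (w n)\<^sup>2
       = (\<Sum>j = 1..n. doc_kernel A n j * (v j)\<^sup>2)
         + (\<Sum>j = 1..n - 1. (1 / rcc_kernel A n j - 1 / rcc_kernel A n (j + 1))
              * (\<Sum>k = 1..j. rcc_kernel A n k * (v k - v (k - 1)))\<^sup>2)"
proof -
  let ?r = "rcc_kernel A n"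
  obtain m where n: "n = Suc m" using \<open>1 \<le> n\<close> by (cases n) auto
  have v0: "v 0 = 0" by (simp add: v_def)
  have last: "doc_kernel A n n = ?r n" "?r n = 1 / A n n"
    by (simp_all add: rcc_kernel_def doc_kernel.simps[of A n n])
  have "w n = (\<Sum>j = 1..n. doc_kernel A n j * v j)"
    unfolding v_def using doc_kernel_inverts[of n A w] diag \<open>1 \<le> n\<close> by simp
  also have "\<dots> = (\<Sum>j = 1..n. (?r j - ?r (j + 1)) * v j)"
    by (intro sum.cong) (auto simp: doc_kernel_eq_rcc_diff)
  also have "\<dots> = (\<Sum>k = 1..n. ?r k * (v k - v (k - 1)))"
    using sum_by_parts_forward[where v = v and r = ?r and m = n, OF v0] by (simp add: rcc_kernel_beyond)
  finally have w: "(\<Sum>k = 1..n. ?r k * (v k - v (k - 1))) = w n" by simp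
  \<comment> \<open>At \<open>j = n\<close> the RCC difference is \<open>?r n\<close> itself, the RCC kernel beyond the level being an empty sum.\<close>
  have "(\<Sum>j = 1..n - 1. (?r j - ?r (j + 1)) * (v j)\<^sup>2) + ?r n * (v n)\<^sup>2
      = (\<Sum>j = 1..n - 1. doc_kernel A n j * (v j)\<^sup>2) + doc_kernel A n n * (v n)\<^sup>2"
    unfolding last(1) by (intro arg_cong2[of _ _ _ _ "(+)"] sum.cong) (auto simp: doc_kernel_eq_rcc_diff)
  also have "\<dots> = (\<Sum>j = 1..n. doc_kernel A n j * (v j)\<^sup>2)"
    by (simp add: n)
  finally show ?thesis
    using square_telescoping_identity[where v = v and r = ?r and n = n, OF v0 \<open>1 \<le> n\<close> rcc] last(2)
    unfolding w by (simp add: mult.commute)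
qed

section \<open>Monotonicity of the averaged fractional kernel\<close>

text \<open>
  The kernel \<open>\<omega>\<^bsub>\<beta>+1\<^esub>\<close>, by \<open>\<Gamma>(\<beta> + 1) = \<beta> \<Gamma>(\<beta>)\<close>.  It vanishes at \<open>0\<close> and is continuous there,
  so the fundamental theorem of calculus applies across the singularity of \<open>\<omega>\<^sub>\<beta>\<close>.
\<close>

definition omega_primitive :: "real \<Rightarrow> real \<Rightarrow> real" where
  "omega_primitive \<beta> y = y powr \<beta> / (\<beta> * Gamma \<beta>)"

lemma omega_primitive_deriv:
  assumes "0 < \<beta>" "0 < y"
  shows "(omega_primitive \<beta> has_real_derivative omega \<beta> y) (at y)"
  unfolding omega_primitive_def[abs_def] omega_def
proof -
  have "((\<lambda>y. y powr \<beta> / (\<beta> * Gamma \<beta>)) has_real_derivative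
      (\<beta> * y powr (\<beta> - 1)) / (\<beta> * Gamma \<beta>)) (at y)"
    using assms(2) by (intro DERIV_cdivide has_real_derivative_powr)
  then show "((\<lambda>y. y powr \<beta> / (\<beta> * Gamma \<beta>)) has_real_derivative
      y powr (\<beta> - 1) / Gamma \<beta>) (at y)"
    using assms(1) by simp
qed

lemma continuous_on_omega_primitive [continuous_intros]:
  assumes "0 < \<beta>" "continuous_on S f" "\<And>x. x \<in> S \<Longrightarrow> 0 \<le> f x"
  shows "continuous_on S (\<lambda>x. omega_primitive \<beta> (f x))"
proof -
  have "continuous_on S (\<lambda>x. f x powr \<beta>)"
    using assms by (intro continuous_on_powr' continuous_on_const) auto
  moreover have "Gamma \<beta> \<noteq> 0"
    using Gamma_real_pos[OF assms(1)] by linarith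
  ultimately show ?thesis
    unfolding omega_primitive_def using assms(1) by (intro continuous_on_divide continuous_on_const) auto
qed

lemma omega_integral:
  assumes "0 < \<beta>" "a \<le> b" "b \<le> x"
  shows "integral {a..b} (\<lambda>s. omega \<beta> (x - s)) = omega_primitive \<beta> (x - a) - omega_primitive \<beta> (x - b)"
proof -
  have "((\<lambda>s. omega \<beta> (x - s)) has_integral
      (- omega_primitive \<beta> (x - b)) - (- omega_primitive \<beta> (x - a))) {a..b}"
  proof (rule fundamental_theorem_of_calculus_interior[OF assms(2)])
    show "continuous_on {a..b} (\<lambda>s. - omega_primitive \<beta> (x - s))"
      using assms by (intro continuous_intros) auto
    show "((\<lambda>s. - omega_primitive \<beta> (x - s)) has_vector_derivative omega \<beta> (x - s)) (at s)"
      if "s \<in> {a<..<b}" for s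
    proof -
      have "((\<lambda>s. omega_primitive \<beta> (x - s)) has_real_derivative omega \<beta> (x - s) * (-1)) (at s)"
        using that assms by (intro DERIV_chain2[OF omega_primitive_deriv]) (auto intro!: derivative_eq_intros)
      from DERIV_minus[OF this] show ?thesis
        by (simp add: has_real_derivative_iff_has_vector_derivative)
    qed
  qed
  from integral_unique[OF this] show ?thesis by simp
qed

text \<open>
  The integral of \<open>\<omega>\<^sub>\<beta>(x - s)\<close> over \<open>s \<in> [a, b]\<close> decreases as \<open>x\<close> moves away, as \<open>\<omega>\<^sub>\<beta>\<close> does.  It
  is stated for the primitive, which has no singularity at \<open>x = b\<close>.
\<close>

lemma omega_integral_antimono:
  assumes "0 < \<beta>" "\<beta> < 1" "a \<le> b" "b \<le> x" "x \<le> y"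
  shows "omega_primitive \<beta> (y - a) - omega_primitive \<beta> (y - b)
    \<le> omega_primitive \<beta> (x - a) - omega_primitive \<beta> (x - b)"
proof (rule DERIV_nonpos_imp_decreasing_open[OF \<open>x \<le> y\<close>])
  show "continuous_on {x..y} (\<lambda>z. omega_primitive \<beta> (z - a) - omega_primitive \<beta> (z - b))"
    using assms by (intro continuous_intros) auto
  fix z assume z: "x < z" "z < y"
  have shift: "((\<lambda>z. omega_primitive \<beta> (z - e)) has_real_derivative omega \<beta> (z - e) * 1) (at z)"
    if "e < z" for e
  proof (rule DERIV_chain2[OF omega_primitive_deriv])
    show "((\<lambda>z. z - e) has_real_derivative 1) (at z)"
      by (auto intro!: derivative_eq_intros)
  qed (use that assms(1) in auto)
  have "((\<lambda>z. omega_primitive \<beta> (z - a) - omega_primitive \<beta> (z - b)) has_real_derivative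
     omega \<beta> (z - a) - omega \<beta> (z - b)) (at z)"
    using DERIV_diff[OF shift[of a] shift[of b]] z assms by simp
  moreover have "omega \<beta> (z - a) \<le> omega \<beta> (z - b)"
    unfolding omega_def using z assms
    by (intro divide_right_mono powr_mono2') (auto intro: Gamma_real_pos less_imp_le)
  ultimately show "\<exists>D. ((\<lambda>z. omega_primitive \<beta> (z - a) - omega_primitive \<beta> (z - b))
      has_real_derivative D) (at z) \<and> D \<le> 0"
    by (intro exI[of _ "omega \<beta> (z - a) - omega \<beta> (z - b)"]) auto
qed

lemma a_kernel_diag:
  assumes "0 < \<beta>" "t (n - 1) < t n"
  shows "a_kernel \<beta> t n n = omega_primitive \<beta> (tau t n) / ((1 + \<beta>) * tau t n)"
proof -
  let ?a = "t (n - 1)" and ?b = "t n"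
  have "integral {?a..?b} (\<lambda>x. integral {?a..min x ?b} (\<lambda>s. omega \<beta> (x - s)))
      = integral {?a..?b} (\<lambda>x. omega_primitive \<beta> (x - ?a))"
    using assms by (intro integral_cong) (auto simp: omega_integral min_absorb1 omega_primitive_def)
  also have "\<dots> = (?b - ?a) * omega_primitive \<beta> (?b - ?a) / (1 + \<beta>)"
  proof -
    let ?F = "\<lambda>x. (x - ?a) powr (1 + \<beta>) / ((1 + \<beta>) * (\<beta> * Gamma \<beta>))"
    have "Gamma \<beta> \<noteq> 0" using Gamma_real_pos[OF assms(1)] by linarith
    then have nz: "(1 + \<beta>) * (\<beta> * Gamma \<beta>) \<noteq> 0"
      using assms(1) by simp
    have "continuous_on {?a..?b} (\<lambda>x. (x - ?a) powr (1 + \<beta>))"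
      using assms by (intro continuous_on_powr' continuous_intros) auto
    then have cont: "continuous_on {?a..?b} ?F"
      using nz by (intro continuous_on_divide continuous_on_const) auto
    have "((\<lambda>x. omega_primitive \<beta> (x - ?a)) has_integral (?F ?b - ?F ?a)) {?a..?b}"
    proof (rule fundamental_theorem_of_calculus_interior)
      show "continuous_on {?a..?b} ?F"
        by (rule cont)
      show "(?F has_vector_derivative omega_primitive \<beta> (x - ?a)) (at x)" if "x \<in> {?a<..<?b}" for x
      proof -
        have "((\<lambda>x. x - ?a) has_real_derivative 1) (at x)"
          by (auto intro!: derivative_eq_intros)
        then have "((\<lambda>x. (x - ?a) powr (1 + \<beta>)) has_real_derivative
            (1 + \<beta>) * (x - ?a) powr \<beta>) (at x)"
          using DERIV_fun_powr[of "\<lambda>x. x - ?a" 1 x "1 + \<beta>"] that by simp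
        from DERIV_cdivide[OF this, of "(1 + \<beta>) * (\<beta> * Gamma \<beta>)"] show ?thesis
          using nz by (simp add: has_real_derivative_iff_has_vector_derivative omega_primitive_def)
      qed
    qed (use assms in auto)
    from integral_unique[OF this] show ?thesis
      using assms by (simp add: omega_primitive_def powr_add)
  qed
  finally show ?thesis
    using assms(2) by (simp add: a_kernel_def tau_def)
qed

text \<open>
  An entry off the diagonal is the mean of the decreasing function \<open>g\<close> over the time cell \<open>n\<close>, so
  it lies between the values of \<open>g\<close> at the ends.  Consecutive entries of a column share the
  value at the common end, which makes the column decrease.
\<close>

lemma a_kernel_offdiag_bounds:
  assumes "0 < \<beta>" "\<beta> < 1" "t (k - 1) < t k" "t k \<le> t (n - 1)" "t (n - 1) < t n" "k \<noteq> n"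
  defines "g \<equiv> \<lambda>x. (omega_primitive \<beta> (x - t (k - 1)) - omega_primitive \<beta> (x - t k)) / tau t k"
  shows "g (t n) \<le> a_kernel \<beta> t n k" "a_kernel \<beta> t n k \<le> g (t (n - 1))"
proof -
  let ?a = "t (n - 1)" and ?b = "t n"
  define h where "h = (\<lambda>x. omega_primitive \<beta> (x - t (k - 1)) - omega_primitive \<beta> (x - t k))"
  have "integral {?a..?b} (\<lambda>x. integral {t (k - 1)..min x (t k)} (\<lambda>s. omega \<beta> (x - s)))
      = integral {?a..?b} h"
    using assms by (intro integral_cong) (auto simp: omega_integral min_absorb2 h_def)
  then have a: "a_kernel \<beta> t n k = integral {?a..?b} h / (tau t n * tau t k)"
    by (simp add: a_kernel_def)
  have int: "h integrable_on {?a..?b}"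
    unfolding h_def using assms
    by (intro integrable_continuous_real continuous_intros) auto
  have mono: "h y \<le> h x" if "t k \<le> x" "x \<le> y" for x y
    unfolding h_def using omega_integral_antimono[of \<beta> "t (k-1)" "t k" x y] assms that by simp
  have "integral {?a..?b} (\<lambda>_. h ?b) \<le> integral {?a..?b} h"
    by (rule integral_le) (use int mono assms in auto)
  moreover have "integral {?a..?b} h \<le> integral {?a..?b} (\<lambda>_. h ?a)"
    by (rule integral_le) (use int mono assms in auto)
  ultimately have lo: "h ?b \<le> integral {?a..?b} h / tau t n"
    and hi: "integral {?a..?b} h / tau t n \<le> h ?a"
    using assms by (simp_all add: tau_def pos_le_divide_eq pos_divide_le_eq mult.commute)
  have "0 \<le> tau t k" using assms by (simp add: tau_def)
  from divide_right_mono[OF lo this] divide_right_mono[OF hi this]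
  show "g (t n) \<le> a_kernel \<beta> t n k" "a_kernel \<beta> t n k \<le> g (t (n - 1))"
    by (simp_all add: a g_def h_def)
qed

lemma mesh_mono:
  fixes t :: "nat \<Rightarrow> real"
  assumes "\<And>k. k \<in> {1..N} \<Longrightarrow> t (k - 1) < t k" "i \<le> j" "j \<le> N"
  shows "t i \<le> t j"
  using assms(2,3)
proof (induction j rule: dec_induct)
  case (step j)
  then show ?case using assms(1)[of "Suc j"] by simp
qed simp

text \<open>
  Below the diagonal, the bounds at the common time level separate consecutive entries.  At the
  diagonal, the neighbour is at most \<open>\<omega>\<^bsub>\<beta>+1\<^esub>(\<tau>\<^sub>k) / \<tau>\<^sub>k\<close>, whereas the doubled diagonal entry is
  \<open>2 / (1 + \<beta>)\<close> times this, and \<open>\<beta> < 1\<close>.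
\<close>

lemma rcc_mod_kernel_pos:
  assumes "0 < \<beta>" "\<beta> < 1" and mesh: "\<And>k. k \<in> {1..N} \<Longrightarrow> t (k - 1) < t k"
    and "n \<le> N" "k \<in> {1..n}"
  shows "rcc_kernel (mod_kernel \<beta> t) n k > 0"
proof (rule rcc_kernel_pos[OF _ _ _ \<open>k \<in> {1..n}\<close>])
  have primitive_pos: "omega_primitive \<beta> y > 0" if "y > 0" for y
    using that \<open>0 < \<beta>\<close> by (simp add: omega_primitive_def Gamma_real_pos)
  fix k assume "k \<in> {1..n}"
  with mesh \<open>n \<le> N\<close> have tk: "t (k - 1) < t k" by simp
  then show "mod_kernel \<beta> t k k > 0"
    using primitive_pos[of "tau t k"] \<open>0 < \<beta>\<close> by (simp add: mod_kernel_def a_kernel_diag tau_def)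
next
  fix k assume k: "1 \<le> k" "k < n"
  have tk: "t (k - 1) < t k" "t k < t (k + 1)"
    using mesh[of k] mesh[of "k + 1"] k \<open>n \<le> N\<close> by auto
  have pos: "omega_primitive \<beta> (tau t k) > 0" "tau t k > 0"
    using tk \<open>0 < \<beta>\<close> by (auto simp: omega_primitive_def Gamma_real_pos tau_def)
  have "a_kernel \<beta> t (k + 1) k \<le> omega_primitive \<beta> (tau t k) / tau t k"
    using a_kernel_offdiag_bounds(2)[of \<beta> t k "k + 1"] assms(1,2) tk
    by (simp add: tau_def omega_primitive_def)
  also have "\<dots> < 2 * (omega_primitive \<beta> (tau t k) / ((1 + \<beta>) * tau t k))"
    using pos assms(1,2) by (simp add: divide_simps)
  finally show "mod_kernel \<beta> t (k + 1) k < mod_kernel \<beta> t k k"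
    using tk assms(1) by (simp add: mod_kernel_def a_kernel_diag)
next
  fix k j assume kj: "1 \<le> k" "k < j" "j < n"
  have tk: "t (k - 1) < t k" "t (j - 1) < t j" "t j < t (j + 1)"
    using mesh[of k] mesh[of j] mesh[of "j + 1"] kj \<open>n \<le> N\<close> by auto
  have "t k \<le> t (j - 1)"
    using kj \<open>n \<le> N\<close> by (intro mesh_mono[of N] mesh) auto
  define g where "g = (\<lambda>x. (omega_primitive \<beta> (x - t (k - 1)) - omega_primitive \<beta> (x - t k)) / tau t k)"
  have "a_kernel \<beta> t (j + 1) k \<le> g (t (j + 1 - 1))"
    unfolding g_def by (rule a_kernel_offdiag_bounds(2)) (use assms(1,2) tk kj \<open>t k \<le> t (j - 1)\<close> in auto)
  also have "g (t (j + 1 - 1)) \<le> a_kernel \<beta> t j k"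
    unfolding g_def add_diff_cancel_right'
    by (rule a_kernel_offdiag_bounds(1)) (use assms(1,2) tk kj \<open>t k \<le> t (j - 1)\<close> in auto)
  finally show "mod_kernel \<beta> t (j + 1) k \<le> mod_kernel \<beta> t j k"
    using kj by (simp add: mod_kernel_def)
qed

section \<open>Partial derivatives of smooth functions\<close>

lemma has_partial_deriv:
  assumes "(w has_derivative D) (at x)"
  shows "partial_deriv i w x = D (axis i 1)"
  using frechet_derivative_at[OF assms] by (simp add: partial_deriv_def)

lemma has_derivative_partials:
  assumes "w differentiable (at x)"
  shows "(w has_derivative (\<lambda>h. \<Sum>i\<in>UNIV. h $ i * partial_deriv i w x)) (at x)"
proof -
  let ?D = "frechet_derivative w (at x)"
  have D: "(w has_derivative ?D) (at x)"
    using assms by (simp add: frechet_derivative_works)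
  then have lin: "linear ?D" by (rule has_derivative_linear)
  have "?D h = (\<Sum>i\<in>UNIV. h $ i * partial_deriv i w x)" for h
  proof -
    have "?D h = ?D (\<Sum>i\<in>UNIV. h $ i *\<^sub>R axis i 1)"
      by (simp add: basis_expansion flip: scalar_mult_eq_scaleR)
    also have "\<dots> = (\<Sum>i\<in>UNIV. h $ i * partial_deriv i w x)"
      by (simp add: linear_sum[OF lin] linear_scale[OF lin] partial_deriv_def)
    finally show ?thesis .
  qed
  then have "?D = (\<lambda>h. \<Sum>i\<in>UNIV. h $ i * partial_deriv i w x)" by (rule ext)
  with D show ?thesis by simp
qed

lemma C1_fun_has_derivative:
  "C1_fun w \<Longrightarrow> (w has_derivative frechet_derivative w (at x)) (at x)"
  by (simp add: C1_fun_def frechet_derivative_works)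

lemma C1_fun_continuous: "C1_fun w \<Longrightarrow> continuous_on S w"
  by (metis C1_fun_def differentiable_imp_continuous_within continuous_at_imp_continuous_on)

lemma C1_fun_partial_continuous: "C1_fun w \<Longrightarrow> continuous_on S (partial_deriv i w)"
  by (metis C1_fun_def continuous_on_subset subset_UNIV)

lemma
  assumes "C1_fun f" "C1_fun g"
  shows partial_deriv_lincomb:
      "partial_deriv i (\<lambda>x. a * f x + b * g x) = (\<lambda>x. a * partial_deriv i f x + b * partial_deriv i g x)"
    and C1_fun_lincomb: "C1_fun (\<lambda>x. a * f x + b * g x)"
proof -
  have D: "((\<lambda>x. a * f x + b * g x) has_derivative
      (\<lambda>h. a * frechet_derivative f (at x) h + b * frechet_derivative g (at x) h)) (at x)" for x
    by (intro derivative_intros C1_fun_has_derivative assms)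
  show eq: "partial_deriv i (\<lambda>x. a * f x + b * g x)
      = (\<lambda>x. a * partial_deriv i f x + b * partial_deriv i g x)" for i
    by (rule ext) (simp add: has_partial_deriv[OF D], simp add: partial_deriv_def)
  show "C1_fun (\<lambda>x. a * f x + b * g x)"
    unfolding C1_fun_def eq
    using D by (auto simp: differentiable_def intro!: continuous_intros C1_fun_partial_continuous assms)
qed

lemma
  assumes "C1_fun f" "C1_fun g"
  shows partial_deriv_mult:
      "partial_deriv i (\<lambda>x. f x * g x) = (\<lambda>x. f x * partial_deriv i g x + partial_deriv i f x * g x)"
    and C1_fun_mult: "C1_fun (\<lambda>x. f x * g x)"
proof -
  have D: "((\<lambda>x. f x * g x) has_derivative
      (\<lambda>h. f x * frechet_derivative g (at x) h + frechet_derivative f (at x) h * g x)) (at x)" for x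
    by (intro derivative_intros C1_fun_has_derivative assms)
  show eq: "partial_deriv i (\<lambda>x. f x * g x)
      = (\<lambda>x. f x * partial_deriv i g x + partial_deriv i f x * g x)" for i
    by (rule ext) (simp add: has_partial_deriv[OF D], simp add: partial_deriv_def)
  show "C1_fun (\<lambda>x. f x * g x)"
    unfolding C1_fun_def eq
    using D by (auto simp: differentiable_def
        intro!: continuous_intros C1_fun_continuous[OF assms(1)] C1_fun_continuous[OF assms(2)]
          C1_fun_partial_continuous assms)
qed

lemma C2_fun_lincomb:
  assumes "C2_fun f" "C2_fun g"
  shows "C2_fun (\<lambda>x. a * f x + b * g x)"
  using assms unfolding C2_fun_def by (auto simp: partial_deriv_lincomb intro: C1_fun_lincomb)

lemma laplacian_continuous: "C2_fun w \<Longrightarrow> continuous_on S (laplacian w)"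
  unfolding C2_fun_def laplacian_def[abs_def]
  by (intro continuous_intros C1_fun_partial_continuous) auto

lemma grad_continuous: "C1_fun w \<Longrightarrow> continuous_on S (grad w)"
  unfolding grad_def[abs_def] by (intro continuous_intros C1_fun_partial_continuous)

section \<open>Integration by parts over a periodic cell\<close>

lemma cell_periodic_partial_deriv:
  assumes "C1_fun w" "cell_periodic B w"
  shows "cell_periodic B (partial_deriv i w)"
  unfolding cell_periodic_def
proof (intro allI)
  fix j x
  have "((\<lambda>y. w (y + column j B)) has_derivative frechet_derivative w (at (x + column j B))) (at x)"
    by (rule has_derivative_compose[where g = w and f = "\<lambda>y. y + column j B", simplified])
      (auto intro!: derivative_eq_intros C1_fun_has_derivative assms)
  moreover have "(\<lambda>y. w (y + column j B)) = w"
    using assms(2) by (auto simp: cell_periodic_def)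
  ultimately show "partial_deriv i w (x + column j B) = partial_deriv i w x"
    using has_partial_deriv by (metis partial_deriv_def)
qed

text \<open>
  The translated cube sticks out by a slab \<open>1 \<le> y\<^sub>j \<le> 1 + s\<close>, which periodicity carries back
  to the missing slab \<open>0 \<le> y\<^sub>j \<le> s\<close>.
\<close>

lemma integral_translate_periodic:
  fixes \<phi> :: "real^'n \<Rightarrow> real"
  assumes cont: "continuous_on UNIV \<phi>" and per: "\<And>y. \<phi> (y + axis j 1) = \<phi> y"
    and s: "0 \<le> s" "s \<le> 1"
  shows "integral (cbox 0 1) (\<lambda>y. \<phi> (y + s *\<^sub>R axis j 1)) = integral (cbox 0 1) \<phi>"
proof -
  let ?e = "axis j 1 :: real^'n"
  have int: "\<phi> integrable_on cbox a b" for a b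
    by (rule integrable_continuous) (rule continuous_on_subset[OF cont], simp)
  have eB: "?e \<in> Basis" by (simp add: axis_in_Basis_iff)
  have dot: "y \<bullet> ?e = y $ j" for y by (simp add: inner_axis)
  define low where "low = (\<chi> i. if i = j then s else 1)"
  have split_j: "(\<forall>i. P i) \<longleftrightarrow> P j \<and> (\<forall>i. i \<noteq> j \<longrightarrow> P i)" for P :: "'n \<Rightarrow> bool"
    by metis
  have mem: "y \<in> cbox a b \<longleftrightarrow> (a $ j \<le> y $ j \<and> y $ j \<le> b $ j)
      \<and> (\<forall>i. i \<noteq> j \<longrightarrow> a $ i \<le> y $ i \<and> y $ i \<le> b $ i)" for y a b :: "real^'n"
    unfolding mem_box_cart by (rule split_j)
  have e: "?e $ i = (if i = j then 1 else 0)" for i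
    by (simp add: axis_def)
  have box_low: "cbox 0 1 \<inter> {y. y \<bullet> ?e \<le> s} = cbox 0 low"
    using s by (auto simp: mem dot low_def)
  have box_shift: "cbox (s *\<^sub>R ?e) (1 + s *\<^sub>R ?e) \<inter> {y. y \<bullet> ?e \<ge> 1} = cbox (0 + ?e) (low + ?e)"
    using s by (auto simp: mem dot low_def e)
  have box_high: "cbox (s *\<^sub>R ?e) (1 + s *\<^sub>R ?e) \<inter> {y. y \<bullet> ?e \<le> 1} = cbox 0 1 \<inter> {y. y \<bullet> ?e \<ge> s}"
    using s by (auto simp: mem dot e)
  have "integral (cbox 0 1) (\<lambda>y. \<phi> (y + s *\<^sub>R ?e)) = integral (cbox (s *\<^sub>R ?e) (1 + s *\<^sub>R ?e)) \<phi>"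
    using integral_shift_cbox_plus[of 0 1 \<phi> "s *\<^sub>R ?e"] by (simp add: o_def add.commute)
  also have "\<dots> = integral (cbox (s *\<^sub>R ?e) (1 + s *\<^sub>R ?e) \<inter> {y. y \<bullet> ?e \<le> 1}) \<phi>
      + integral (cbox (s *\<^sub>R ?e) (1 + s *\<^sub>R ?e) \<inter> {y. y \<bullet> ?e \<ge> 1}) \<phi>"
    by (rule integral_split[OF int eB])
  also have "integral (cbox (s *\<^sub>R ?e) (1 + s *\<^sub>R ?e) \<inter> {y. y \<bullet> ?e \<ge> 1}) \<phi> = integral (cbox 0 low) \<phi>"
    unfolding box_shift integral_shift_cbox_plus[symmetric]
    using per by (simp add: o_def add.commute)
  also have "integral (cbox (s *\<^sub>R ?e) (1 + s *\<^sub>R ?e) \<inter> {y. y \<bullet> ?e \<le> 1}) \<phi> + integral (cbox 0 low) \<phi>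
      = integral (cbox 0 1) \<phi>"
    unfolding box_high box_low[symmetric]
    using integral_split[OF int eB, of 0 1 s] by simp
  finally show ?thesis .
qed

text \<open>
  Differentiate under the integral sign: the integral of the translates of \<open>g\<close> does not depend on
  the shift \<open>s\<close>, so its derivative, the integral of \<open>h'\<close>, vanishes.
\<close>

lemma integral_periodic_directional_deriv:
  fixes g h' :: "real^'n \<Rightarrow> real"
  assumes deriv: "\<And>y. ((\<lambda>s. g (y + s *\<^sub>R axis j 1)) has_real_derivative h' y) (at 0)"
    and cont: "continuous_on UNIV g" "continuous_on UNIV h'"
    and per: "\<And>y. g (y + axis j 1) = g y"
  shows "integral (cbox 0 1) h' = 0"
proof -
  let ?e = "axis j 1 :: real^'n"
  let ?I = "\<lambda>s. integral (cbox 0 1) (\<lambda>y. g (y + s *\<^sub>R ?e))"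
  have "((\<lambda>s. g (y + s *\<^sub>R ?e)) has_real_derivative h' (y + s0 *\<^sub>R ?e)) (at s0)" for y s0
    using deriv[of "y + s0 *\<^sub>R ?e"] DERIV_shift[of "\<lambda>s. g (y + s *\<^sub>R ?e)" "h' (y + s0 *\<^sub>R ?e)" 0 s0]
    by (simp add: algebra_simps)
  then have "(?I has_real_derivative integral (cbox 0 1) (\<lambda>y. h' (y + 0 *\<^sub>R ?e))) (at 0 within {0..1})"
    by (intro leibniz_rule_field_derivative)
      (auto intro: has_field_derivative_at_within simp: case_prod_unfold
        intro!: integrable_continuous continuous_on_compose2[OF cont(1)]
        continuous_on_compose2[OF cont(2)] continuous_intros)
  \<comment> \<open>Translation invariance is known for shifts in \<open>[0, 1]\<close>, so the derivative at \<open>0\<close> is one-sided.\<close>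
  then have 1: "(?I has_vector_derivative integral (cbox 0 1) h') (at 0 within cbox 0 1)"
    by (simp add: has_real_derivative_iff_has_vector_derivative)
  have "(?I has_vector_derivative 0) (at 0 within cbox 0 1)"
    by (rule has_vector_derivative_transform[where f = "\<lambda>_. ?I 0"])
      (auto simp: integral_translate_periodic[OF cont(1) per])
  with 1 show ?thesis
    by (rule vector_derivative_unique_within_closed_interval[rotated 2]) auto
qed

lemma continuous_compact_absolutely_integrable:
  fixes f :: "'a::euclidean_space \<Rightarrow> 'b::euclidean_space"
  assumes "compact S" "continuous_on S f"
  shows "f absolutely_integrable_on S"
proof -
  have int: "integrable lborel (\<lambda>x. indicator S x *\<^sub>R f x)"
    by (rule borel_integrable_compact[OF assms])
  then show ?thesis
    unfolding set_integrable_def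
    using integrable_completion[OF borel_measurable_integrable[OF int]] by blast
qed

lemma compact_periodic_cell: "compact (periodic_cell c B)"
  unfolding periodic_cell_def
  by (intro compact_continuous_image continuous_intros compact_cbox linear_continuous_on)
    (simp add: linear_conv_bounded_linear[symmetric])

lemma integrable_periodic_cell:
  fixes f :: "real^2 \<Rightarrow> real"
  assumes "continuous_on UNIV f"
  shows "f integrable_on periodic_cell c B"
  using continuous_compact_absolutely_integrable[OF compact_periodic_cell continuous_on_subset[OF assms subset_UNIV]]
  by (rule set_lebesgue_integral_eq_integral(1))

lemma integral_periodic_cell:
  fixes f :: "real^2 \<Rightarrow> real"
  assumes "continuous_on UNIV f" "invertible B"
  shows "integral (periodic_cell c B) f = \<bar>det B\<bar> * integral (cbox 0 1) (\<lambda>y. f (c + B *v y))"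
proof -
  let ?g = "\<lambda>y. c + B *v y"
  \<comment> \<open>The change of variables theorem takes vector-valued integrands, hence one-dimensional vectors.\<close>
  let ?F = "\<lambda>x. vec (f x) :: real^1"
  let ?G = "\<lambda>x. \<bar>det (matrix ((*v) B))\<bar> *\<^sub>R ?F (?g x)"
  have contF: "continuous_on UNIV ?F"
    unfolding vec_def by (intro continuous_intros assms(1))
  have intF: "?F absolutely_integrable_on ?g ` cbox 0 1"
    using continuous_compact_absolutely_integrable[OF compact_periodic_cell continuous_on_subset[OF contF]]
    unfolding periodic_cell_def by blast
  have "(?g has_derivative (*v) B) (at x within cbox 0 1)" for x
    by (auto intro!: derivative_eq_intros bounded_linear_imp_has_derivative
      simp: linear_conv_bounded_linear[symmetric])
  moreover have "inj_on ?g (cbox 0 1)"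
    using assms(2) by (auto simp: inj_on_def dest: injD[OF inj_matrix_vector_mult])
  ultimately have "?G absolutely_integrable_on cbox 0 1"
    "integral (cbox 0 1) ?G = integral (?g ` cbox 0 1) ?F"
    using has_absolute_integral_change_of_variables_compact[of "cbox 0 1" ?g "\<lambda>_. (*v) B" ?F
        "integral (?g ` cbox 0 1) ?F"] intF by auto
  then have "integral (cbox 0 1) (\<lambda>x. ?G x $ 1) = integral (?g ` cbox 0 1) (\<lambda>x. ?F x $ 1)"
    using integral_component_eq_cart[of ?F "?g ` cbox 0 1" 1] integral_component_eq_cart[of ?G "cbox 0 1" 1]
      set_lebesgue_integral_eq_integral(1)[OF intF] set_lebesgue_integral_eq_integral(1)
    by metis
  then show ?thesis by (simp add: periodic_cell_def)
qed

text \<open>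
  In the coordinates of the lattice the cell is the unit cube and the periods are the unit vectors,
  so the derivatives along the columns of \<open>B\<close> integrate to zero.  The coordinate directions are
  linear combinations of these columns because \<open>B\<close> is invertible.
\<close>

lemma integral_partial_deriv_periodic:
  assumes "C1_fun g" "cell_periodic B g" "invertible B"
  shows "integral (periodic_cell c B) (partial_deriv i g) = 0"
proof -
  let ?q = "\<lambda>y. c + B *v y"
  let ?h = "\<lambda>j y. \<Sum>k\<in>UNIV. B $ k $ j * partial_deriv k g (?q y)"
  have cont_q: "continuous_on UNIV ?q"
    by (intro continuous_intros linear_continuous_on) (simp add: linear_conv_bounded_linear[symmetric])
  have cont_p: "continuous_on S (\<lambda>y. partial_deriv k g (?q y))" for k S
    by (rule continuous_on_compose2[OF C1_fun_partial_continuous[OF assms(1)]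
          continuous_on_subset[OF cont_q]]) auto
  have zero: "integral (cbox 0 1) (?h j) = 0" for j
  proof (rule integral_periodic_directional_deriv[where g = "\<lambda>y. g (?q y)" and j = j])
    have step: "?q (y + s *\<^sub>R axis j 1) = ?q y + s *\<^sub>R column j B" for y s
      by (simp add: matrix_vector_right_distrib matrix_vector_mult_scaleR matrix_vector_mult_basis)
    show "g (?q (y + axis j 1)) = g (?q y)" for y
      using step[of y 1] assms(2) by (simp add: cell_periodic_def flip: add.assoc)
    show "continuous_on UNIV (\<lambda>y. g (?q y))"
      by (rule continuous_on_compose2[OF C1_fun_continuous[OF assms(1)] cont_q]) auto
    show "continuous_on UNIV (?h j)"
      by (intro continuous_intros cont_p)
    show "((\<lambda>s. g (?q (y + s *\<^sub>R axis j 1))) has_real_derivative ?h j y) (at 0)" for y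
    proof -
      have "((\<lambda>s. ?q y + s *\<^sub>R column j B) has_derivative (\<lambda>s. s *\<^sub>R column j B)) (at 0)"
        by (auto intro!: derivative_eq_intros)
      moreover have "(g has_derivative (\<lambda>v. \<Sum>k\<in>UNIV. v $ k * partial_deriv k g (?q y)))
          (at (?q y + 0 *\<^sub>R column j B))"
        using assms(1) has_derivative_partials[of g "?q y"] by (simp add: C1_fun_def)
      ultimately have "((\<lambda>s. g (?q y + s *\<^sub>R column j B)) has_derivative
          (\<lambda>s. \<Sum>k\<in>UNIV. (s *\<^sub>R column j B) $ k * partial_deriv k g (?q y))) (at 0)"
        by (rule has_derivative_compose)
      then show ?thesis
        unfolding step has_field_derivative_def
        by (rule has_derivative_eq_rhs) (auto simp: column_def sum_distrib_left mult_ac)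
    qed
  qed
  \<comment> \<open>The column \<open>i\<close> of the inverse \<open>C\<close> expresses the unit vector \<open>i\<close> in the columns of \<open>B\<close>.\<close>
  obtain C where C: "B ** C = mat 1" using assms(3) by (auto simp: invertible_def)
  have inv: "partial_deriv i g (?q y) = (\<Sum>j\<in>UNIV. C $ j $ i * ?h j y)" for y
  proof -
    have "(\<Sum>j\<in>UNIV. C $ j $ i * ?h j y)
        = (\<Sum>k\<in>UNIV. (B ** C) $ k $ i * partial_deriv k g (?q y))"
      unfolding matrix_matrix_mult_def
      by (simp add: sum_distrib_left sum_distrib_right mult_ac) (rule sum.swap)
    also have "\<dots> = partial_deriv i g (?q y)"
      by (simp add: C mat_def if_distrib[of "\<lambda>x. x * _"] cong: if_cong)
    finally show ?thesis by simp
  qed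
  have "integral (cbox 0 1) (\<lambda>y. partial_deriv i g (?q y))
      = (\<Sum>j\<in>UNIV. C $ j $ i * integral (cbox 0 1) (?h j))"
    unfolding inv
    by (subst integral_sum) (auto intro!: integrable_continuous continuous_intros cont_p)
  then show ?thesis
    using integral_periodic_cell[OF C1_fun_partial_continuous[OF assms(1)] assms(3)] zero by simp
qed

lemma integral_sum_scaled_periodic_cell:
  fixes f :: "nat \<Rightarrow> real^2 \<Rightarrow> real"
  assumes "\<And>j. j \<in> I \<Longrightarrow> continuous_on UNIV (f j)" "finite I"
  shows "integral (periodic_cell c B) (\<lambda>x. \<Sum>j\<in>I. a j * f j x)
       = (\<Sum>j\<in>I. a j * integral (periodic_cell c B) (f j))"
  using assms by (subst integral_sum) (auto intro!: integrable_periodic_cell continuous_intros)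

text \<open>
  The divergence of the periodic field \<open>\<phi> \<nabla>m\<close> integrates to zero.
\<close>

lemma integral_green_periodic:
  assumes "C1_fun \<phi>" "cell_periodic B \<phi>" "C2_fun m" "cell_periodic B m" "invertible B"
  shows "integral (periodic_cell c B) (\<lambda>x. \<phi> x * laplacian m x)
       = - integral (periodic_cell c B) (\<lambda>x. grad \<phi> x \<bullet> grad m x)"
proof -
  let ?\<Omega> = "periodic_cell c B"
  have m: "C1_fun m" "\<And>i. C1_fun (partial_deriv i m)"
    using assms(3) by (auto simp: C2_fun_def)
  have zero: "integral ?\<Omega> (partial_deriv i (\<lambda>x. \<phi> x * partial_deriv i m x)) = 0" for i
    using assms cell_periodic_partial_deriv[OF m(1) assms(4)]
    by (intro integral_partial_deriv_periodic C1_fun_mult m(2)) (auto simp: cell_periodic_def)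
  have cont: "continuous_on UNIV (partial_deriv i (\<lambda>x. \<phi> x * partial_deriv i m x))" for i
    by (intro C1_fun_partial_continuous C1_fun_mult assms(1) m(2))
  have pointwise: "(\<Sum>i\<in>UNIV. partial_deriv i (\<lambda>x. \<phi> x * partial_deriv i m x) x)
      = \<phi> x * laplacian m x + grad \<phi> x \<bullet> grad m x" for x
    by (simp add: partial_deriv_mult[OF assms(1) m(2)] laplacian_def grad_def inner_vec_def
        sum.distrib sum_distrib_left)
  have "0 = integral ?\<Omega> (\<lambda>x. \<Sum>i\<in>UNIV. partial_deriv i (\<lambda>x. \<phi> x * partial_deriv i m x) x)"
    by (subst integral_sum) (auto intro: integrable_periodic_cell cont simp: zero)
  also have "\<dots> = integral ?\<Omega> (\<lambda>x. \<phi> x * laplacian m x) + integral ?\<Omega> (\<lambda>x. grad \<phi> x \<bullet> grad m x)"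
    unfolding pointwise
    by (intro Henstock_Kurzweil_Integration.integral_add integrable_periodic_cell continuous_intros
        C1_fun_continuous assms laplacian_continuous grad_continuous m)
  finally show ?thesis by simp
qed

section \<open>The increment of the classical energy\<close>

lemma mid_eq_lincomb: "mid u n = (\<lambda>x. (1/2) * u n x + (1/2) * u (n - 1) x)"
  by (rule ext) (simp add: mid_def)

lemma zeta_continuous:
  assumes "C2_fun (u n)" "C2_fun (u (n - 1))"
  shows "continuous_on S (zeta \<epsilon> u n)"
proof -
  have "C2_fun (mid u n)"
    unfolding mid_eq_lincomb by (intro C2_fun_lincomb assms)
  moreover from this have "C1_fun (mid u n)" "C1_fun (u n)" "C1_fun (u (n - 1))"
    using assms by (auto simp: C2_fun_def)
  ultimately show ?thesis
    unfolding zeta_def[abs_def] f_mid_def[abs_def]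
    by (intro continuous_intros laplacian_continuous C1_fun_continuous)
qed

text \<open>
  With \<open>p = u\<^sup>n\<close> and \<open>q = u\<^bsup>n-1\<^esup>\<close>, the factors \<open>p - q\<close> and \<open>(p + q) / 2\<close> combine to differences of
  squares both in \<open>(p - q) f(u)\<^bsup>n-1/2\<^esup>\<close>, which is the difference of the potentials
  \<open>(u\<^sup>2 - 1)\<^sup>2 / 4\<close>, and in the gradient term left by Green's formula.
\<close>

lemma energy_increment:
  fixes c :: "real^2" and B :: "real^2^2"
  assumes "C2_fun (u n)" "C2_fun (u (n - 1))" "cell_periodic B (u n)" "cell_periodic B (u (n - 1))"
    "invertible B"
  defines "\<Omega> \<equiv> periodic_cell c B"
  shows "energy \<epsilon> \<Omega> (u n) - energy \<epsilon> \<Omega> (u (n - 1))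
       = integral \<Omega> (\<lambda>x. (u n x - u (n - 1) x) * zeta \<epsilon> u n x)"
proof -
  \<comment> \<open>The difference is written with explicit coefficients to fit the rules for linear combinations.\<close>
  define p q m \<phi> where "p = u n" and "q = u (n - 1)" and "m = mid u n"
    and "\<phi> = (\<lambda>x. 1 * p x + (-1) * q x)"
  have pq: "C2_fun p" "C2_fun q" "C1_fun p" "C1_fun q"
    using assms by (auto simp: p_def q_def C2_fun_def)
  have m_eq: "m = (\<lambda>x. (1/2) * p x + (1/2) * q x)"
    by (simp add: m_def mid_eq_lincomb p_def q_def)
  have mC: "C2_fun m" "C1_fun m" "C1_fun \<phi>"
    using C2_fun_lincomb[OF pq(1,2), of "1/2" "1/2"] C1_fun_lincomb[OF pq(3,4), of 1 "-1"]
    by (auto simp: m_eq \<phi>_def C2_fun_def)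
  have per: "cell_periodic B m" "cell_periodic B \<phi>"
    using assms by (auto simp: cell_periodic_def m_eq \<phi>_def p_def q_def)
  have grads: "grad \<phi> x \<bullet> grad m x = (1/2) * ((norm (grad p x))\<^sup>2 - (norm (grad q x))\<^sup>2)" for x
  proof -
    have "grad \<phi> x = grad p x - grad q x" "grad m x = (1/2) *\<^sub>R (grad p x + grad q x)"
      unfolding vec_eq_iff grad_def \<phi>_def m_eq partial_deriv_lincomb[OF pq(3,4)]
      by (simp_all add: field_simps)
    then show ?thesis
      by (simp add: power2_norm_eq_inner inner_diff_left inner_diff_right inner_add_left inner_add_right inner_commute)
  qed
  have "continuous_on UNIV (f_mid u n)"
    unfolding f_mid_def[abs_def] m_def[symmetric] p_def[symmetric] q_def[symmetric]
    by (intro continuous_intros C1_fun_continuous pq mC)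
  then have cont: "continuous_on UNIV (\<lambda>x. \<phi> x * f_mid u n x)"
    by (intro continuous_intros C1_fun_continuous[OF mC(3)])
  have cont': "continuous_on UNIV (\<lambda>x. grad \<phi> x \<bullet> grad m x)"
    by (intro continuous_intros grad_continuous mC)
  have cont'': "continuous_on UNIV (\<lambda>x. \<phi> x * laplacian m x)"
    by (intro continuous_intros C1_fun_continuous laplacian_continuous mC)
  have energy_cont: "continuous_on UNIV (\<lambda>x. \<epsilon>\<^sup>2 / 2 * (norm (grad w x))\<^sup>2 + 1 / 4 * ((w x)\<^sup>2 - 1)\<^sup>2)"
    if "C1_fun w" for w
    using that by (intro continuous_intros C1_fun_continuous grad_continuous)
  have "integral \<Omega> (\<lambda>x. \<phi> x * zeta \<epsilon> u n x)
      = integral \<Omega> (\<lambda>x. \<phi> x * f_mid u n x - \<epsilon>\<^sup>2 * (\<phi> x * laplacian m x))"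
    by (simp add: zeta_def m_def algebra_simps)
  also have "\<dots> = integral \<Omega> (\<lambda>x. \<phi> x * f_mid u n x) - \<epsilon>\<^sup>2 * integral \<Omega> (\<lambda>x. \<phi> x * laplacian m x)"
    unfolding \<Omega>_def
    by (subst Henstock_Kurzweil_Integration.integral_diff)
      (auto intro!: integrable_periodic_cell cont cont' cont'' continuous_intros)
  also have "\<dots> = integral \<Omega> (\<lambda>x. \<phi> x * f_mid u n x) + \<epsilon>\<^sup>2 * integral \<Omega> (\<lambda>x. grad \<phi> x \<bullet> grad m x)"
    unfolding \<Omega>_def integral_green_periodic[OF mC(3) per(2) mC(1) per(1) assms(5)] by simp
  also have "\<dots> = integral \<Omega> (\<lambda>x. \<phi> x * f_mid u n x + \<epsilon>\<^sup>2 * (grad \<phi> x \<bullet> grad m x))"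
    unfolding \<Omega>_def
    by (subst Henstock_Kurzweil_Integration.integral_add)
      (auto intro!: integrable_periodic_cell cont cont' cont'' continuous_intros)
  also have "(\<lambda>x. \<phi> x * f_mid u n x + \<epsilon>\<^sup>2 * (grad \<phi> x \<bullet> grad m x))
      = (\<lambda>x. (\<epsilon>\<^sup>2 / 2 * (norm (grad p x))\<^sup>2 + 1 / 4 * ((p x)\<^sup>2 - 1)\<^sup>2)
           - (\<epsilon>\<^sup>2 / 2 * (norm (grad q x))\<^sup>2 + 1 / 4 * ((q x)\<^sup>2 - 1)\<^sup>2))"
    unfolding grads
    by (rule ext) (simp add: \<phi>_def f_mid_def mid_def p_def q_def field_simps power2_eq_square)
  also have "integral \<Omega> \<dots> = energy \<epsilon> \<Omega> p - energy \<epsilon> \<Omega> q"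
    unfolding \<Omega>_def energy_def
    by (intro Henstock_Kurzweil_Integration.integral_diff integrable_periodic_cell energy_cont pq)
  finally show ?thesis by (simp add: \<phi>_def p_def q_def)
qed

section \<open>The discrete energy dissipation law\<close>

text \<open>
  An integral that does not exist is \<open>0\<close>, so the radicand is nonnegative in all cases.
\<close>

lemma L2_norm_squared: "(L2_norm \<Omega> w)\<^sup>2 = integral \<Omega> (\<lambda>x. (w x)\<^sup>2)"
proof -
  have "0 \<le> integral \<Omega> (\<lambda>x. (w x)\<^sup>2)"
    by (cases "(\<lambda>x. (w x)\<^sup>2) integrable_on \<Omega>")
      (auto intro: Henstock_Kurzweil_Integration.integral_nonneg simp: not_integrable_integral)
  then show ?thesis by (simp add: L2_norm_def)
qed

theorem theorem4p1:
  fixes \<beta> \<epsilon> T :: real and N :: nat and t :: "nat \<Rightarrow> real"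
    and c :: "real^2" and B :: "real^2^2" and \<Omega> :: "(real^2) set"
    and u :: "nat \<Rightarrow> real^2 \<Rightarrow> real"
  assumes "0 < \<beta>" and "\<beta> < 1" and "\<epsilon> > 0"
    and "t 0 = 0" and "t N = T" and "\<And>k. k \<in> {1..N} \<Longrightarrow> t (k - 1) < t k"
    and "\<And>k. k \<in> {2..N - 1} \<Longrightarrow> step_ratio t (k + 1) \<ge> r_star \<beta> (step_ratio t k)"
    and "invertible B" and "\<Omega> = periodic_cell c B"
    and "\<And>n. n \<le> N \<Longrightarrow> C2_fun (u n)"
    and "\<And>n. n \<le> N \<Longrightarrow> cell_periodic B (u n)"
    and "CN_scheme \<beta> \<epsilon> \<Omega> t N u"
  shows "\<forall>n\<in>{1..N}.
    (mod_energy \<beta> \<epsilon> \<Omega> t u n - mod_energy \<beta> \<epsilon> \<Omega> t u (n - 1)) / tau t n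
    + 1 / (2 * tau t n) *
      (\<Sum>j = 1..n - 1.
        (1 / rcc_kernel (mod_kernel \<beta> t) n j - 1 / rcc_kernel (mod_kernel \<beta> t) n (j + 1)) *
        (L2_norm \<Omega> (\<lambda>x. \<Sum>k = 1..j.
           rcc_kernel (mod_kernel \<beta> t) n k * (v_aux \<beta> \<epsilon> t u k x - v_aux \<beta> \<epsilon> t u (k - 1) x)))\<^sup>2)
    = 0"
proof
  fix n assume n: "n \<in> {1..N}"
  define A r v w S where "A = mod_kernel \<beta> t" and "r = rcc_kernel A n"
    and "v = v_aux \<beta> \<epsilon> t u" and "w = (\<lambda>l x. tau t l * zeta \<epsilon> u l x)"
    and "S = (\<lambda>j x. \<Sum>k = 1..j. r k * (v k x - v (k - 1) x))"
  have v_eq: "v j x = (\<Sum>l = 1..j. A j l * w l x)" for j x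
    by (simp add: v_def v_aux_def w_def A_def mult.assoc)
  have tau_pos: "tau t k > 0" if "k \<in> {1..N}" for k
    using assms(6)[OF that] by (simp add: tau_def)
  have r_pos: "r k > 0" if "k \<in> {1..n}" for k
    unfolding r_def A_def
    using rcc_mod_kernel_pos[OF assms(1,2), of N t n k] assms(6) n that by auto
  have diag: "A k k \<noteq> 0" if "k \<in> {1..n}" for k
    using rcc_mod_kernel_pos[OF assms(1,2), of N t k k] assms(6) n that
    by (auto simp: A_def rcc_kernel_def doc_kernel.simps[of _ k k])
  have zeta_cont: "continuous_on UNIV (zeta \<epsilon> u k)" if "k \<le> N" for k
    using assms(10) that by (intro zeta_continuous) auto
  have w_cont: "continuous_on UNIV (w k)" if "k \<le> n" for k
    unfolding w_def using n that by (intro continuous_intros zeta_cont) auto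
  have v_cont: "continuous_on UNIV (v k)" if "k \<le> n" for k
    unfolding v_eq[abs_def] using that by (intro continuous_intros w_cont) auto
  have S_cont: "continuous_on UNIV (S k)" if "k \<le> n" for k
    unfolding S_def using that by (intro continuous_intros v_cont) auto
  have pointwise: "- 2 * ((u n x - u (n - 1) x) * zeta \<epsilon> u n x)
      = (\<Sum>j = 1..n. doc_kernel A n j * (v j x)\<^sup>2)
        + (\<Sum>j = 1..n - 1. (1 / r j - 1 / r (j + 1)) * (S j x)\<^sup>2)" if x: "x \<in> \<Omega>" for x
  proof -
    have "(u n x - u (n - 1) x) / tau t n
        + (\<Sum>k = 1..n. a_kernel \<beta> t n k * tau t k * zeta \<epsilon> u k x) = 0"
      using assms(12) n x by (auto simp: CN_scheme_def)
    \<comment> \<open>The modified diagonal is twice the original one, so half of its contribution is removed.\<close>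
    moreover have "(\<Sum>k = 1..n. a_kernel \<beta> t n k * tau t k * zeta \<epsilon> u k x)
        = v n x - A n n * w n x / 2"
    proof -
      obtain m where m: "n = Suc m" using n by (cases n) auto
      show ?thesis
        unfolding v_eq m by (simp add: A_def mod_kernel_def w_def mult.assoc)
    qed
    ultimately have "(u n x - u (n - 1) x) / tau t n = - (v n x - A n n * w n x / 2)"
      by simp
    then have "u n x - u (n - 1) x = - (v n x - A n n * w n x / 2) * tau t n"
      using tau_pos[OF n] by (simp add: divide_eq_eq)
    then have "(u n x - u (n - 1) x) * zeta \<epsilon> u n x = - (v n x - A n n * w n x / 2) * w n x"
      by (simp add: w_def)
    then have "- 2 * ((u n x - u (n - 1) x) * zeta \<epsilon> u n x) = 2 * w n x * v n x - A n n * (w n x)\<^sup>2"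
      by (simp add: field_simps power2_eq_square)
    also have "\<dots> = (\<Sum>j = 1..n. doc_kernel A n j * (v j x)\<^sup>2)
        + (\<Sum>j = 1..n - 1. (1 / r j - 1 / r (j + 1)) * (S j x)\<^sup>2)"
      using kernel_dissipation[of n A "\<lambda>l. w l x"] n diag r_pos
      unfolding v_eq S_def r_def by fastforce
    finally show ?thesis .
  qed
  have "- 2 * (energy \<epsilon> \<Omega> (u n) - energy \<epsilon> \<Omega> (u (n - 1)))
      = integral \<Omega> (\<lambda>x. - 2 * ((u n x - u (n - 1) x) * zeta \<epsilon> u n x))"
  proof -
    have "energy \<epsilon> \<Omega> (u n) - energy \<epsilon> \<Omega> (u (n - 1))
        = integral \<Omega> (\<lambda>x. (u n x - u (n - 1) x) * zeta \<epsilon> u n x)"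
      unfolding assms(9) using n by (intro energy_increment assms(8,10,11)) auto
    then show ?thesis by simp
  qed
  also have "\<dots> = integral \<Omega> (\<lambda>x. (\<Sum>j = 1..n. doc_kernel A n j * (v j x)\<^sup>2)
        + (\<Sum>j = 1..n - 1. (1 / r j - 1 / r (j + 1)) * (S j x)\<^sup>2))"
    by (rule integral_cong) (rule pointwise)
  also have "\<dots> = integral \<Omega> (\<lambda>x. \<Sum>j = 1..n. doc_kernel A n j * (v j x)\<^sup>2)
        + integral \<Omega> (\<lambda>x. \<Sum>j = 1..n - 1. (1 / r j - 1 / r (j + 1)) * (S j x)\<^sup>2)"
    unfolding assms(9)
    by (intro Henstock_Kurzweil_Integration.integral_add integrable_periodic_cell)
      (intro continuous_intros v_cont S_cont; auto)+
  also have "\<dots> = (\<Sum>j = 1..n. doc_kernel A n j * (L2_norm \<Omega> (v j))\<^sup>2)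
        + (\<Sum>j = 1..n - 1. (1 / r j - 1 / r (j + 1)) * (L2_norm \<Omega> (S j))\<^sup>2)"
    unfolding assms(9) L2_norm_squared
    by (intro arg_cong2[of _ _ _ _ "(+)"] integral_sum_scaled_periodic_cell)
      (auto intro!: continuous_intros v_cont S_cont)
  finally have "mod_energy \<beta> \<epsilon> \<Omega> t u n - mod_energy \<beta> \<epsilon> \<Omega> t u (n - 1)
      + (1 / 2) * (\<Sum>j = 1..n - 1. (1 / r j - 1 / r (j + 1)) * (L2_norm \<Omega> (S j))\<^sup>2) = 0"
    using sum_dcc_kernel_step[of n A "\<lambda>j. (L2_norm \<Omega> (v j))\<^sup>2"] n
    unfolding mod_energy_def A_def[symmetric] v_def[symmetric] by (simp add: field_simps)
  moreover have "x / tau t n + 1 / (2 * tau t n) * y = (x + (1 / 2) * y) / tau t n" for x y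
    by (simp add: add_divide_distrib)
  moreover have "(\<lambda>x. \<Sum>k = 1..j. r k * (v k x - v (k - 1) x)) = S j" for j
    by (simp add: S_def)
  ultimately show "(mod_energy \<beta> \<epsilon> \<Omega> t u n - mod_energy \<beta> \<epsilon> \<Omega> t u (n - 1)) / tau t n
    + 1 / (2 * tau t n) *
      (\<Sum>j = 1..n - 1.
        (1 / rcc_kernel (mod_kernel \<beta> t) n j - 1 / rcc_kernel (mod_kernel \<beta> t) n (j + 1)) *
        (L2_norm \<Omega> (\<lambda>x. \<Sum>k = 1..j.
           rcc_kernel (mod_kernel \<beta> t) n k * (v_aux \<beta> \<epsilon> t u k x - v_aux \<beta> \<epsilon> t u (k - 1) x)))\<^sup>2)
    = 0"
    unfolding A_def[symmetric] v_def[symmetric] r_def[symmetric] by simp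
qed

end
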